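(* Let $\mu>0$, $\alpha>0$. Assume that $f:\mathbb{R}^d\to\mathbb{R}$ is $C^2$ and that there are constants $0<m\le M<+\infty$ with $m I\le\nabla^2 f(x)\le M I$ for all $x\in\mathbb{R}^d$ (in the sense of symmetric matrices); let $x^*$ be the unique minimizer of $f$. Assume that $A$ is a function on $\mathbb{R}^d$ with values in the space of symmetric positive semidefinite $d\times d$ matrices, bounded on compact sets, and that $\gamma>0$. Fix $L\ge 0$. Then, for any initial condition $(x_0,p_0,\xi_0)\in\mathbb{R}^d\times\mathbb{R}^d\times[0,\infty)$ such that $$\|x_0\|+\|p_0\|+\xi_0\le L,$$ there exist $\delta t^\star>0$, $\kappa>0$ and $C\ge 0$, depending on $L$ (and on $f,A,\mu,\alpha,\gamma$) but not otherwise on the initial condition, such that, for all $\delta t\in(0,\delta t^\star)$ and all $n\ge 0$, the iterates $(x_n,p_n,\xi_n)$ of the C'D'BA scheme with time step $\delta t$ started from $(x_0,p_0,\xi_0)$ satisfy $$f(x_n)-f(x^* )+\|p_n\|^2+\xi_n^2\le C\,\mathrm{e}^{-\kappa n\delta t}.$$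
   Context: Given $f:\mathbb{R}^d\to\mathbb{R}$ differentiable, $A:\mathbb{R}^d\to\mathbb{R}^{d\times d}$ with symmetric positive semidefinite values, parameters $\mu>0,\alpha>0,\gamma\ge 0$ and a time step $\delta t>0$, the C'D'BA scheme maps $(x_n,p_n,\xi_n)\in\mathbb{R}^d\times\mathbb{R}^d\times[0,\infty)$ to $(x_{n+1},p_{n+1},\xi_{n+1})$ defined by $$p_{n+1}=\mathrm{e}^{-(\gamma I+\xi_nA(x_n))\delta t}p_n-\delta t\,\nabla f(x_n),$$ $$x_{n+1}=x_n+\delta t\,p_{n+1},$$ $$\xi_{n+1}=\mathrm{e}^{-\alpha\delta t}\sqrt{\xi_n^2+\frac1\mu\,p_n^T\left(I-\mathrm{e}^{-2\xi_nA(x_n)\delta t}\right)p_n}\,.$$ Here the exponentials of matrices are matrix exponentials, $I$ is the $d\times d$ identity, and $\|\cdot\|$ is the Euclidean norm. (It is a splitting discretization of the ODE system $\dot x=p$, $\dot p=-\nabla f(x)-\xi A(x)p-\gamma p$, $\dot\xi=\mu^{-1}p^TA(x)p-\alpha\xi$.) *)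

theory Defs
  imports "HOL-Analysis.Analysis"
begin

text \<open>
  On \<open>real ^ 'd ^ 'd\<close> the operations \<open>*\<close>, \<open>1\<close>, \<open>^\<close> and \<open>\<le>\<close> of the type classes are componentwise,
  so the matrix product \<open>**\<close>, the identity \<open>mat 1\<close> and the notions below are used instead.
\<close>

primrec matpow :: "real ^ 'd ^ 'd \<Rightarrow> nat \<Rightarrow> real ^ 'd ^ 'd" where
  "matpow A 0 = mat 1"
| "matpow A (Suc k) = A ** matpow A k"

definition mexp :: "real ^ 'd ^ 'd \<Rightarrow> real ^ 'd ^ 'd" where
  "mexp A = (\<Sum>k. (1 / fact k) *\<^sub>R matpow A k)"

lemma mexp_summable: "summable (\<lambda>k. (1 / fact k) *\<^sub>R matpow (A :: real ^ 'd ^ 'd) k)"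
proof -
  define K where "K = onorm ((*v) A)"
  have bl: "bounded_linear ((*v) A)"
    by (rule matrix_vector_mul_bounded_linear)
  have K0: "0 \<le> K"
    unfolding K_def by (rule onorm_pos_le[OF bl])
  have pow: "norm (matpow A k *v x) \<le> K ^ k * norm x" for k x
  proof (induction k)
    case 0
    then show ?case by simp
  next
    case (Suc k)
    have "norm (matpow A (Suc k) *v x) = norm (A *v (matpow A k *v x))"
      by (simp add: matrix_vector_mul_assoc)
    also have "\<dots> \<le> K * norm (matpow A k *v x)"
      unfolding K_def by (rule onorm[OF bl])
    also have "\<dots> \<le> K * (K ^ k * norm x)"
      by (rule mult_left_mono[OF Suc K0])
    finally show ?case by (simp add: mult.assoc)
  qed
  have entry: "\<bar>matpow A k $ i $ j\<bar> \<le> K ^ k" for k i j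
  proof -
    have "\<bar>matpow A k $ i $ j\<bar> = \<bar>(matpow A k *v axis j 1) $ i\<bar>"
      by (simp add: matrix_vector_mul_component inner_axis)
    also have "\<dots> \<le> norm (matpow A k *v axis j 1)"
      by (rule component_le_norm_cart)
    also have "\<dots> \<le> K ^ k"
      using pow[of k "axis j 1"] by simp
    finally show ?thesis .
  qed
  define c where "c = real CARD('d) * real CARD('d)"
  have bound: "norm (matpow A k) \<le> c * K ^ k" for k
  proof -
    have "norm (matpow A k) \<le> (\<Sum>i\<in>UNIV. norm (matpow A k $ i))"
      by (simp add: norm_vec_def L2_set_le_sum)
    also have "\<dots> \<le> (\<Sum>i\<in>(UNIV::'d set). \<Sum>j\<in>(UNIV::'d set). K ^ k)"
      by (intro sum_mono order_trans[OF norm_le_l1_cart] entry)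
    finally show ?thesis by (simp add: c_def mult.assoc)
  qed
  have "summable (\<lambda>k. c * (inverse (fact k) * K ^ k))"
    by (intro summable_mult summable_exp)
  moreover have "norm ((1 / fact k) *\<^sub>R matpow A k) \<le> c * (inverse (fact k) * K ^ k)" for k
  proof -
    have "norm ((1 / fact k) *\<^sub>R matpow A k) = inverse (fact k) * norm (matpow A k)"
      by (simp add: divide_inverse)
    also have "\<dots> \<le> inverse (fact k) * (c * K ^ k)"
      by (intro mult_left_mono bound) simp
    finally show ?thesis by (simp add: mult.left_commute)
  qed
  ultimately show ?thesis
    by (rule summable_comparison_test'[where N = 0])
qed

definition psd :: "real ^ 'd ^ 'd \<Rightarrow> bool" where
  "psd A \<longleftrightarrow> transpose A = A \<and> (\<forall>v. 0 \<le> v \<bullet> (A *v v))"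

definition loewner_le :: "real ^ 'd ^ 'd \<Rightarrow> real ^ 'd ^ 'd \<Rightarrow> bool" where
  "loewner_le A B \<longleftrightarrow> psd (B - A)"

definition gradient :: "(real ^ 'd \<Rightarrow> real) \<Rightarrow> real ^ 'd \<Rightarrow> real ^ 'd" where
  "gradient f x = (THE D. GDERIV f x :> D)"

definition hessian :: "(real ^ 'd \<Rightarrow> real) \<Rightarrow> real ^ 'd \<Rightarrow> real ^ 'd ^ 'd" where
  "hessian f x = matrix (frechet_derivative (gradient f) (at x))"

definition C2 :: "(real ^ 'd \<Rightarrow> real) \<Rightarrow> bool" where
  "C2 f \<longleftrightarrow>
     (\<forall>x. f differentiable (at x)) \<and>
     (\<forall>x. gradient f differentiable (at x)) \<and>
     continuous_on UNIV (hessian f)"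

lemma gradient_eq:
  assumes "GDERIV f x :> D"
  shows "gradient f x = D"
  unfolding gradient_def
proof (rule the_equality)
  fix E assume "GDERIV f x :> E"
  with assms have "(\<lambda>h. h \<bullet> E) = (\<lambda>h. h \<bullet> D)"
    unfolding gderiv_def by (rule has_derivative_unique[rotated])
  then show "E = D"
    using vector_eq_ldot[of E D] by (simp add: fun_eq_iff)
qed (rule assms)

lemma GDERIV_gradient:
  assumes "f differentiable (at x)"
  shows "GDERIV f x :> gradient f x"
proof -
  from assms obtain f' where f': "(f has_derivative f') (at x)"
    unfolding differentiable_def by blast
  then have lin: "linear f'"
    using has_derivative_bounded_linear bounded_linear.linear by blast
  have "f' = (\<lambda>h. h \<bullet> adjoint f' 1)"
    using adjoint_works[OF lin, of _ 1] by (auto simp: fun_eq_iff inner_commute)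
  with f' have D: "GDERIV f x :> adjoint f' 1"
    unfolding gderiv_def by simp
  then show ?thesis
    by (simp only: gradient_eq[OF D])
qed

text \<open>Only meaningful when \<open>f\<close> has exactly one global minimizer.\<close>
definition the_minimizer :: "(real ^ 'd \<Rightarrow> real) \<Rightarrow> real ^ 'd" where
  "the_minimizer f = (THE x. \<forall>y. f x \<le> f y)"

definition cddba_step ::
  "(real ^ 'd \<Rightarrow> real) \<Rightarrow> (real ^ 'd \<Rightarrow> real ^ 'd ^ 'd) \<Rightarrow> real \<Rightarrow> real \<Rightarrow> real \<Rightarrow> real \<Rightarrow>
   (real ^ 'd) \<times> (real ^ 'd) \<times> real \<Rightarrow> (real ^ 'd) \<times> (real ^ 'd) \<times> real" where
  "cddba_step f A \<mu> \<alpha> \<gamma> \<delta>t = (\<lambda>(x, p, \<xi>).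
     let p' = mexp (- (\<delta>t *\<^sub>R (\<gamma> *\<^sub>R mat 1 + \<xi> *\<^sub>R A x))) *v p - \<delta>t *\<^sub>R gradient f x;
         x' = x + \<delta>t *\<^sub>R p';
         \<xi>' = exp (- \<alpha> * \<delta>t) *
              sqrt (\<xi>\<^sup>2 + 1 / \<mu> * (p \<bullet> ((mat 1 - mexp (- ((2 * \<xi> * \<delta>t) *\<^sub>R A x))) *v p)))
     in (x', p', \<xi>'))"

definition cddba ::
  "(real ^ 'd \<Rightarrow> real) \<Rightarrow> (real ^ 'd \<Rightarrow> real ^ 'd ^ 'd) \<Rightarrow> real \<Rightarrow> real \<Rightarrow> real \<Rightarrow> real \<Rightarrow>
   (real ^ 'd) \<times> (real ^ 'd) \<times> real \<Rightarrow> nat \<Rightarrow> (real ^ 'd) \<times> (real ^ 'd) \<times> real" where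
  "cddba f A \<mu> \<alpha> \<gamma> \<delta>t s n = (cddba_step f A \<mu> \<alpha> \<gamma> \<delta>t ^^ n) s"

end

theory Submission
  imports Defs
begin

text \<open>
  With \<open>y = x - x*\<close> and the energy \<open>H = f(x) - f(x*) + |p|\<^sup>2/2 + \<mu> \<xi>\<^sup>2/2\<close>, the scheme moves kinetic energy lost
  through \<open>A\<close> exactly into \<open>\<xi>\<close> before damping: \<open>\<mu> \<xi>'\<^sup>2\<close> equals \<open>exp (- 2 \<alpha> h) (\<mu> \<xi>\<^sup>2 + |p|\<^sup>2 - |q|\<^sup>2)\<close> with
  \<open>q = mexp (- h \<xi> A) p\<close>. So \<open>H\<close> loses a multiple of \<open>h (|p|\<^sup>2 + \<mu> \<xi>\<^sup>2)\<close> up to second order terms, and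
  adding \<open>\<epsilon> y \<bullet> p\<close> yields decay in \<open>y\<close> by strong convexity. The size of \<open>A\<close> only
  enters the choice of \<open>\<epsilon>\<close>. This is not circular: for every \<open>\<epsilon>\<close> below a bound independent of \<open>A\<close>,
  \<open>V = H + \<epsilon> y \<bullet> p\<close> lies between \<open>H/2\<close> and \<open>2H\<close>, so the sublevel set of \<open>V\<close> containing the initial
  data lies in a compact set fixed in advance, and it is invariant because \<open>V\<close> decreases.
\<close>

section \<open>Flows of matrix exponentials\<close>

lemma bounded_linear_matrix_vector_mult_left:
  "bounded_linear (\<lambda>X :: real ^ 'n ^ 'm. X *v v)"
  by (intro linear_conv_bounded_linear[THEN iffD1] linearI)
     (simp_all add: matrix_vector_mult_add_rdistrib scaleR_matrix_vector_assoc)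

lemma matpow_scaleR: "matpow (t *\<^sub>R C) k = t ^ k *\<^sub>R matpow C k"
proof (induction k)
  case (Suc k)
  then show ?case
    by (simp add: matrix_eq flip: matrix_vector_mul_assoc scaleR_matrix_vector_assoc)
       (simp add: matrix_vector_mult_scaleR)
qed simp

lemma mexp_mult_vec_sums:
  fixes C :: "real ^ 'd ^ 'd"
  shows "(\<lambda>k. (t ^ k / fact k) *\<^sub>R (matpow C k *v v)) sums (mexp (t *\<^sub>R C) *v v)"
  using bounded_linear.sums[OF bounded_linear_matrix_vector_mult_left
      summable_sums[OF mexp_summable[of "t *\<^sub>R C"]], of v]
  by (simp add: mexp_def matpow_scaleR flip: scaleR_matrix_vector_assoc)

lemma mexp_0 [simp]: "mexp 0 = (mat 1 :: real ^ 'd ^ 'd)"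
proof -
  \<comment> \<open>At \<open>t = 0\<close> only the term \<open>k = 0\<close> of the series
    survives, since \<open>0 ^ 0 = 1\<close>.\<close>
  have "mexp 0 *v v = mat 1 *v v" for v :: "real ^ 'd"
    using sums_unique2[OF mexp_mult_vec_sums[of 0 0 v] sums_finite[of "{0}"]] by simp
  then show ?thesis
    by (simp add: matrix_eq)
qed

text \<open>Each component of the flow is an everywhere convergent scalar power series in
  \<open>t\<close>. Termwise differentiation cancels one factor of the factorial and leaves one
  extra factor \<open>C\<close>, which can be pulled out on the left.\<close>

lemma mexp_has_vector_derivative:
  fixes C :: "real ^ 'd ^ 'd"
  shows "((\<lambda>t. mexp (t *\<^sub>R C) *v v) has_vector_derivative C *v (mexp (t *\<^sub>R C) *v v)) (at t)"
proof -
  have comp: "((\<lambda>t. (mexp (t *\<^sub>R C) *v v) $ i) has_real_derivative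
      (C *v (mexp (t *\<^sub>R C) *v v)) $ i) (at t)" for i
  proof -
    define c where "c = (\<lambda>k. (matpow C k *v v) $ i / fact k)"
    have sums: "(\<lambda>k. c k * t ^ k) sums (mexp (t *\<^sub>R C) *v v) $ i" for t
      using bounded_linear.sums[OF bounded_linear_vec_nth mexp_mult_vec_sums[of t C v], of i]
      by (simp add: c_def mult.commute)
    have "(\<lambda>k. diffs c k * t ^ k) sums (C *v (mexp (t *\<^sub>R C) *v v)) $ i"
    proof -
      have "(\<lambda>k. (C *v ((t ^ k / fact k) *\<^sub>R (matpow C k *v v))) $ i)
          sums (C *v (mexp (t *\<^sub>R C) *v v)) $ i"
        by (intro bounded_linear.sums[OF bounded_linear_vec_nth]
            bounded_linear.sums[OF matrix_vector_mul_bounded_linear] mexp_mult_vec_sums)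
      moreover have "(C *v ((t ^ k / fact k) *\<^sub>R (matpow C k *v v))) $ i = diffs c k * t ^ k" for k
        by (simp add: diffs_def c_def matrix_vector_mult_scaleR matrix_vector_mul_assoc
            field_simps del: of_nat_Suc)
      ultimately show ?thesis by simp
    qed
    with termdiffs_strong_converges_everywhere[of c t] sums show ?thesis
      by (simp add: sums_iff)
  qed
  then show ?thesis
    unfolding has_vector_derivative_def
    by (subst has_derivative_componentwise_within)
       (auto simp: Basis_vec_def inner_axis has_field_derivative_def mult_commute_abs)
qed

lemma mexp_has_vector_derivative' [derivative_intros]:
  assumes "(g has_real_derivative g') (at t)"
  shows "((\<lambda>t. mexp (g t *\<^sub>R C) *v v) has_vector_derivative
    g' *\<^sub>R (C *v (mexp (g t *\<^sub>R C) *v v))) (at t)"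
  using vector_diff_chain_at[of g g' t, OF _ mexp_has_vector_derivative[of C v "g t"]] assms
  by (simp add: has_real_derivative_iff_has_vector_derivative o_def)

lemma has_real_derivative_inner [derivative_intros]:
  fixes u v :: "real \<Rightarrow> 'a :: real_inner"
  assumes "(u has_vector_derivative u') (at t)" and "(v has_vector_derivative v') (at t)"
  shows "((\<lambda>t. u t \<bullet> v t) has_real_derivative u t \<bullet> v' + u' \<bullet> v t) (at t)"
  unfolding has_field_derivative_def
  by (rule has_derivative_eq_rhs[OF has_derivative_inner[OF assms[unfolded has_vector_derivative_def]]])
     (simp add: fun_eq_iff algebra_simps)

section \<open>Contraction flows generated by positive semidefinite matrices\<close>

lemma psd_symmetric: "psd B \<Longrightarrow> (B *v u) \<bullet> v = u \<bullet> (B *v v)"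
  by (metis dot_lmul_matrix psd_def transpose_matrix_vector)

lemma psd_scaleR: "psd B \<Longrightarrow> 0 \<le> c \<Longrightarrow> psd (c *\<^sub>R B)"
  by (simp add: psd_def transpose_def vec_eq_iff flip: scaleR_matrix_vector_assoc)

lemma psd_add_mat:
  assumes "psd B" and "0 \<le> c"
  shows "psd (c *\<^sub>R mat 1 + B)"
  using assms
  by (simp add: psd_def matrix_vector_mult_add_rdistrib inner_add_right
        flip: scaleR_matrix_vector_assoc)
     (simp add: transpose_def vec_eq_iff mat_def)

text \<open>The squared norm has derivative \<open>- 2 * (u t \<bullet> (B *v u t))\<close>, which
  is nonpositive. Besides contractivity this gives uniqueness: a solution that starts at 0 remains
  0.\<close>

lemma linear_flow_norm_antimono:
  fixes u :: "real \<Rightarrow> real ^ 'd"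
  assumes "psd B" and u: "\<And>t. (u has_vector_derivative - (B *v u t)) (at t)" and "0 \<le> t"
  shows "norm (u t) \<le> norm (u 0)"
proof -
  have "\<exists>y. ((\<lambda>t. u t \<bullet> u t) has_real_derivative y) (at s) \<and> y \<le> 0" for s
  proof (intro exI conjI)
    show "((\<lambda>t. u t \<bullet> u t) has_real_derivative u s \<bullet> - (B *v u s) + - (B *v u s) \<bullet> u s) (at s)"
      by (intro derivative_intros u)
    show "u s \<bullet> - (B *v u s) + - (B *v u s) \<bullet> u s \<le> 0"
      using \<open>psd B\<close> by (simp add: psd_def inner_commute)
  qed
  from DERIV_nonpos_imp_nonincreasing[OF \<open>0 \<le> t\<close>, of "\<lambda>t. u t \<bullet> u t", OF this]
  show ?thesis by (simp add: norm_le)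
qed

lemma mexp_uminus_flow:
  "((\<lambda>t. mexp (- (t *\<^sub>R B)) *v v) has_vector_derivative - (B *v (mexp (- (t *\<^sub>R B)) *v v))) (at t)"
  using mexp_has_vector_derivative'[OF DERIV_minus[OF DERIV_ident], of B v t] by simp

lemma norm_mexp_uminus_le:
  assumes "psd B"
  shows "norm (mexp (- B) *v v) \<le> norm v"
  using linear_flow_norm_antimono[OF assms mexp_uminus_flow, of 1 v] by simp

text \<open>The flow has velocity of norm at most \<open>K * norm v\<close> by contractivity, so the
  mean value inequality over unit time applies. The bound is linear in \<open>K\<close>, whereas
  estimating the series term by term would give an exponential.\<close>

lemma norm_mexp_uminus_diff_le:
  assumes "psd B" and K: "\<And>w. norm (B *v w) \<le> K * norm w"
  shows "norm (mexp (- B) *v v - v) \<le> K * norm v"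
proof -
  let ?u = "\<lambda>t. mexp (- (t *\<^sub>R B)) *v v"
  have K0: "0 \<le> K * norm v"
    using norm_ge_zero K order_trans by blast
  have "norm (?u 1 - ?u 0) \<le> K * norm v * norm (1 - 0 :: real)"
  proof (rule differentiable_bound)
    show "(?u has_derivative (\<lambda>h. h *\<^sub>R (- (B *v ?u t)))) (at t within {0..1})" for t
      using mexp_uminus_flow[of B v t] unfolding has_vector_derivative_def
      by (rule has_derivative_at_withinI)
    show "onorm (\<lambda>h. h *\<^sub>R (- (B *v ?u t))) \<le> K * norm v" if "t \<in> {0..1}" for t :: real
    proof -
      have "norm (?u t) \<le> norm v"
        using linear_flow_norm_antimono[OF assms(1) mexp_uminus_flow, of t v] that by simp
      \<comment> \<open>A negative \<open>K\<close> would force \<open>v = 0\<close> and hence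
        \<open>?u t = 0\<close>, so the comparison holds for either sign.\<close>
      then have "norm (B *v ?u t) \<le> K * norm v"
        using K[of "?u t"] K[of v]
        by (smt (verit, best) K0 mult_left_mono norm_ge_zero zero_le_mult_iff norm_le_zero_iff mult_eq_0_iff)
      then show ?thesis
        by (intro onorm_le) (simp add: mult.commute mult_left_mono)
    qed
  qed auto
  then show ?thesis by simp
qed

text \<open>
  By symmetry of \<open>B\<close>, the inner product of the flow of \<open>- B\<close> at times \<open>1 - s\<close> and \<open>1 + s\<close> does not
  depend on \<open>s\<close>; this avoids proving the semigroup law.
\<close>
lemma mexp_uminus_scaleR_2:
  assumes "psd B"
  shows "v \<bullet> (mexp (- (2 *\<^sub>R B)) *v v) = (norm (mexp (- B) *v v))\<^sup>2"
proof -
  define u where "u = (\<lambda>t. mexp (t *\<^sub>R B) *v v)"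
  define w where "w = (\<lambda>s. u (s - 1) \<bullet> u (- s - 1))"
  have "(w has_real_derivative 0) (at s)" for s
    unfolding w_def u_def
    by (auto intro!: derivative_eq_intros simp: psd_symmetric[OF assms])
  then have "w 1 = w 0"
    by (intro DERIV_isconst_all) simp
  then show ?thesis
    by (simp add: w_def u_def power2_norm_eq_inner)
qed

text \<open>Both sides, with time inserted, solve the same linear equation with the same initial
  value. Their difference starts at 0 and has nonincreasing norm, so it vanishes.\<close>

lemma mexp_uminus_add_mat:
  assumes "psd B" and "0 \<le> c"
  shows "mexp (- (c *\<^sub>R mat 1 + B)) *v v = exp (- c) *\<^sub>R (mexp (- B) *v v)"
proof -
  let ?C = "c *\<^sub>R mat 1 + B"
  have C: "?C *v w = c *\<^sub>R w + B *v w" for w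
    by (simp add: matrix_vector_mult_add_rdistrib flip: scaleR_matrix_vector_assoc)
  let ?d = "\<lambda>t. mexp (- (t *\<^sub>R ?C)) *v v - exp (- (c * t)) *\<^sub>R (mexp (- (t *\<^sub>R B)) *v v)"
  have "(?d has_vector_derivative - (?C *v ?d t)) (at t)" for t
    by (rule derivative_eq_intros mexp_uminus_flow refl | simp)+
      (simp add: C scaleR_diff_right matrix_vector_mult_diff_distrib
        matrix_vector_mult_scaleR scaleR_add_right mult.commute)
  from linear_flow_norm_antimono[OF psd_add_mat[OF assms] this, of 1] show ?thesis
    by simp
qed

text \<open>Turns boundedness of \<open>A\<close> on a compact set into one operator bound valid at
  all its points. The constant is crude: the number of entries times a bound on the entries.\<close>

lemma bounded_matrices_imp_uniform_bound:
  fixes S :: "(real ^ 'n ^ 'm) set"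
  assumes "bounded S"
  obtains K where "0 \<le> K" and "\<And>X v. X \<in> S \<Longrightarrow> norm (X *v v) \<le> K * norm v"
proof -
  obtain b where b: "0 < b" "\<And>X. X \<in> S \<Longrightarrow> norm X \<le> b"
    using assms bounded_pos by blast
  let ?K = "real CARD('m) * real CARD('n) * b"
  have "norm (X *v v) \<le> ?K * norm v" if "X \<in> S" for X and v :: "real ^ 'n"
  proof -
    have "\<bar>X $ i $ j\<bar> \<le> b" for i j
      using component_le_norm_cart[of "X $ i" j] Finite_Cartesian_Product.norm_nth_le[of X i] b(2)[OF that] by linarith
    then have "onorm ((*v) X) \<le> ?K"
      by (rule onorm_le_matrix_component)
    then have "onorm ((*v) X) * norm v \<le> ?K * norm v"
      by (simp add: mult_right_mono)
    then show ?thesis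
      using onorm[OF matrix_vector_mul_bounded_linear, of X v] by linarith
  qed
  with b(1) show ?thesis
    by (intro that[of ?K]) auto
qed

section \<open>Strongly convex functions\<close>

text \<open>Taylor expansion with Lagrange remainder of \<open>f\<close> along the segment from
  \<open>x\<close> to \<open>x + v\<close>. The position of \<open>z\<close> on the segment is
  dropped because the Hessian bounds are global.\<close>

lemma C2_second_order:
  fixes f :: "real ^ 'd \<Rightarrow> real"
  assumes "C2 f"
  shows "\<exists>z. f (x + v) = f x + v \<bullet> gradient f x + (v \<bullet> (hessian f z *v v)) / 2"
proof -
  define diff where "diff = (\<lambda>(k :: nat) (t :: real). if k = 0 then f (x + t *\<^sub>R v)
    else if k = 1 then v \<bullet> gradient f (x + t *\<^sub>R v)
    else v \<bullet> (hessian f (x + t *\<^sub>R v) *v v))"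
  have line: "((\<lambda>t. x + t *\<^sub>R v) has_derivative (\<lambda>h. h *\<^sub>R v)) (at t)" for t
    by (auto intro!: derivative_eq_intros)
  have d0: "DERIV (diff 0) t :> diff 1 t" for t
  proof -
    have "(f has_derivative (\<lambda>h. h \<bullet> gradient f (x + t *\<^sub>R v))) (at (x + t *\<^sub>R v))"
      using GDERIV_gradient \<open>C2 f\<close> unfolding C2_def gderiv_def by blast
    from has_derivative_compose[OF line this] show ?thesis
      by (simp add: diff_def has_field_derivative_def mult_commute_abs)
  qed
  have d1: "DERIV (diff 1) t :> diff 2 t" for t
  proof -
    let ?z = "x + t *\<^sub>R v"
    have D: "(gradient f has_derivative frechet_derivative (gradient f) (at ?z)) (at ?z)"
      using \<open>C2 f\<close> by (simp add: C2_def frechet_derivative_works)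
    then have "frechet_derivative (gradient f) (at ?z) = (*v) (hessian f ?z)"
      unfolding hessian_def
      by (simp add: fun_eq_iff matrix_works has_derivative_linear)
    with D have "(gradient f has_derivative (*v) (hessian f ?z)) (at ?z)"
      by simp
    from has_derivative_inner_right[OF has_derivative_compose[OF line this], of v] show ?thesis
      by (simp add: diff_def has_field_derivative_def mult_commute_abs matrix_vector_mult_scaleR)
  qed
  have "\<exists>t>0. t < 1 \<and> diff 0 1 = (\<Sum>k<2. diff k 0 / fact k * (1 - 0) ^ k) + diff 2 t / fact 2 * (1 - 0)\<^sup>2"
  proof (rule Taylor_up[where a = 0])
    show "\<forall>k t. k < 2 \<and> 0 \<le> t \<and> t \<le> 1 \<longrightarrow> DERIV (diff k) t :> diff (Suc k) t"
      using d0 d1 by (auto simp: numeral_2_eq_2 less_Suc_eq)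
  qed auto
  then show ?thesis
    by (auto simp: diff_def numeral_2_eq_2 lessThan_Suc)
qed

locale strongly_convex_smooth =
  fixes f :: "real ^ 'd \<Rightarrow> real" and m M :: real
  assumes C2: "C2 f" and m_pos: "0 < m" and m_le_M: "m \<le> M"
    and hess_ge: "\<And>x. loewner_le (m *\<^sub>R mat 1) (hessian f x)"
    and hess_le: "\<And>x. loewner_le (hessian f x) (M *\<^sub>R mat 1)"
begin

lemma M_pos: "0 < M"
  using m_pos m_le_M by simp

lemma quadratic_lower: "f x + v \<bullet> gradient f x + m / 2 * (norm v)\<^sup>2 \<le> f (x + v)"
proof -
  have "m * (norm v)\<^sup>2 \<le> v \<bullet> (hessian f z *v v)" for z
    using hess_ge[of z] unfolding loewner_le_def psd_def
    by (simp add: matrix_vector_mult_diff_rdistrib inner_diff_right power2_norm_eq_inner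
        flip: scaleR_matrix_vector_assoc)
  then show ?thesis
    using C2_second_order[OF C2, of x v] by force
qed

lemma quadratic_upper: "f (x + v) \<le> f x + v \<bullet> gradient f x + M / 2 * (norm v)\<^sup>2"
proof -
  have "v \<bullet> (hessian f z *v v) \<le> M * (norm v)\<^sup>2" for z
    using hess_le[of z] unfolding loewner_le_def psd_def
    by (simp add: matrix_vector_mult_diff_rdistrib inner_diff_right power2_norm_eq_inner
        flip: scaleR_matrix_vector_assoc)
  then show ?thesis
    using C2_second_order[OF C2, of x v] by force
qed

text \<open>A gradient step of length \<open>1 / M\<close> lowers \<open>f\<close> by at least
  \<open>(norm ?g)\<^sup>2 / (2 * M)\<close>, yet cannot go below \<open>c\<close>.\<close>

lemma gradient_sq_le:
  assumes "\<And>y. c \<le> f y"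
  shows "(norm (gradient f x))\<^sup>2 \<le> 2 * M * (f x - c)"
proof -
  let ?g = "gradient f x"
  have "c \<le> f (x + (- (1 / M)) *\<^sub>R ?g)"
    by (rule assms)
  also have "\<dots> \<le> f x + ((- (1 / M)) *\<^sub>R ?g) \<bullet> ?g + M / 2 * (norm ((- (1 / M)) *\<^sub>R ?g))\<^sup>2"
    by (rule quadratic_upper)
  also have "\<dots> = f x - (norm ?g)\<^sup>2 / (2 * M)"
    using M_pos by (simp add: power_mult_distrib power_divide flip: power2_norm_eq_inner)
      (simp add: field_simps power2_eq_square)
  finally show ?thesis
    using M_pos by (simp add: field_simps)
qed

lemma gradient_minimizer:
  assumes "\<And>y. f z \<le> f y"
  shows "gradient f z = 0"
  using gradient_sq_le[OF assms, of z] by simp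

lemma continuous_f: "continuous_on UNIV f"
  using C2 unfolding C2_def
  by (meson continuous_at_imp_continuous_on differentiable_imp_continuous_within)

lemma ex_minimizer: "\<exists>z. \<forall>y. f z \<le> f y"
proof -
  define g where "g = gradient f 0"
  \<comment> \<open>Beyond this radius the quadratic term of the lower bound at 0 outweighs the
    linear one, so \<open>f y\<close> is at least \<open>f 0\<close> there.\<close>
  define r where "r = 2 * norm g / m"
  have r0: "0 \<le> r"
    using m_pos by (simp add: r_def)
  obtain z where z: "\<And>y. y \<in> cball 0 r \<Longrightarrow> f z \<le> f y"
    using continuous_attains_inf[OF compact_cball, of 0 r f] r0
      continuous_on_subset[OF continuous_f] by (metis cball_eq_empty not_less subset_UNIV)
  have "f z \<le> f y" if "norm y > r" for y
  proof -
    have "f z \<le> f 0"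
      using z[of 0] r0 by simp
    also have "f 0 \<le> f 0 + norm y * (m / 2 * norm y - norm g)"
      using that m_pos mult_nonneg_nonneg[of "norm y" "m / 2 * norm y - norm g"]
      by (simp add: r_def field_simps)
    also have "\<dots> \<le> f 0 + y \<bullet> g + m / 2 * (norm y)\<^sup>2"
      using Cauchy_Schwarz_ineq2[of y g] by (simp add: algebra_simps power2_eq_square abs_le_iff)
    also have "\<dots> \<le> f y"
      using quadratic_lower[of 0 y] by (simp add: g_def)
    finally show ?thesis .
  qed
  with z have "f z \<le> f y" for y
    by (cases "norm y \<le> r") auto
  then show ?thesis by blast
qed

text \<open>The definite description is justified by existence and by uniqueness: the quadratic
  lower bound at one minimizer puts every other point strictly higher.\<close>

lemma the_minimizer_le: "f (the_minimizer f) \<le> f y"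
proof -
  obtain z where z: "\<And>y. f z \<le> f y"
    using ex_minimizer by blast
  have "\<forall>y. f (the_minimizer f) \<le> f y"
    unfolding the_minimizer_def
  proof (rule theI[where a = z])
    fix w assume w: "\<forall>y. f w \<le> f y"
    have "f z + m / 2 * (norm (w - z))\<^sup>2 \<le> f w"
      using quadratic_lower[of z "w - z"] gradient_minimizer[OF z] by simp
    with w have "m / 2 * (norm (w - z))\<^sup>2 \<le> 0"
      by (smt (verit))
    then show "w = z"
      using m_pos by (simp add: mult_le_0_iff)
  qed (use z in blast)
  then show ?thesis by blast
qed

lemma gap_lower: "m / 2 * (norm (x - the_minimizer f))\<^sup>2 \<le> f x - f (the_minimizer f)"
  using quadratic_lower[of "the_minimizer f" "x - the_minimizer f"]
    gradient_minimizer[OF the_minimizer_le] by simp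

lemma gap_upper: "f x - f (the_minimizer f) \<le> M / 2 * (norm (x - the_minimizer f))\<^sup>2"
  using quadratic_upper[of "the_minimizer f" "x - the_minimizer f"]
    gradient_minimizer[OF the_minimizer_le] by simp

text \<open>The quadratic lower bound expanded at \<open>x\<close> and evaluated at the minimizer.
  It makes the term \<open>- y \<bullet> g\<close> from the cross term of the Lyapunov function
  dissipate the potential energy.\<close>

lemma gap_le_inner:
  "f x - f (the_minimizer f) + m / 2 * (norm (x - the_minimizer f))\<^sup>2
    \<le> (x - the_minimizer f) \<bullet> gradient f x"
  using quadratic_lower[of x "the_minimizer f - x"]
  by (simp add: inner_diff_left norm_minus_commute)

end

section \<open>Lyapunov function\<close>

text \<open>Follows from \<open>exp t \<ge> 1 + t\<close>, as
  \<open>(1 - t / 2) * (1 + t) = 1 + t * (1 - t) / 2\<close> is at least 1 on the unit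
  interval.\<close>

lemma exp_uminus_le:
  fixes t :: real
  assumes "0 \<le> t" and "t \<le> 1"
  shows "exp (- t) \<le> 1 - t / 2"
proof -
  have "1 \<le> (1 - t / 2) * (1 + t)"
    using assms mult_left_mono[of t 1 t] by (simp add: algebra_simps)
  also have "\<dots> \<le> (1 - t / 2) * exp t"
    using assms by (intro mult_left_mono) (auto simp: exp_ge_add_one_self)
  finally show ?thesis
    by (simp add: exp_minus field_simps)
qed

text \<open>The scheme reduced to scalar inequalities. Later \<open>a\<close>, \<open>b\<close>,
  \<open>c\<close> are \<open>exp (- \<gamma> h)\<close>, \<open>exp (- 2 \<beta> h)\<close>,
  \<open>exp (- 2 \<alpha> h)\<close>, \<open>y\<close> is the offset from the minimizer,
  \<open>F\<close> and \<open>F'\<close> are the gaps before and after the step, \<open>g\<close> is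
  the gradient, and \<open>h R\<close> bounds the relative change of \<open>p\<close> by
  friction.\<close>

lemma lyapunov_step:
  fixes y p p' q g :: "'a :: real_inner" and F F' h a b c \<beta> \<epsilon> \<mu> m M R \<xi> \<xi>' :: real
  assumes "0 < h" and "0 < \<mu>" and "0 < m" and "0 < M" and "0 \<le> \<epsilon>"
    and p': "p' = a *\<^sub>R q - h *\<^sub>R g"
    and qp: "norm q \<le> norm p" and kick: "norm (a *\<^sub>R q - p) \<le> h * (R * norm p)"
    and ab: "a\<^sup>2 \<le> b" and cb: "c \<le> b" and b: "b \<le> 1 - \<beta> * h" and "0 \<le> \<beta>"
    and \<xi>': "\<xi>'\<^sup>2 = c * (\<xi>\<^sup>2 + ((norm p)\<^sup>2 - (norm q)\<^sup>2) / \<mu>)"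
    and F': "F' \<le> F + h * (p' \<bullet> g) + M / 2 * (h\<^sup>2 * (norm p')\<^sup>2)"
    and gap: "0 \<le> F" "F + m / 2 * (norm y)\<^sup>2 \<le> y \<bullet> g" "(norm g)\<^sup>2 \<le> 2 * M * F"
    and h: "h \<le> \<epsilon>" "4 * M * (M + 2) * h\<^sup>2 \<le> 1"
    and \<epsilon>: "\<epsilon> * (M + 2 + R\<^sup>2 / (2 * m)) \<le> \<beta> / 4"
  shows "F' + (norm p')\<^sup>2 / 2 + \<mu> / 2 * \<xi>'\<^sup>2 + \<epsilon> * ((y + h *\<^sub>R p') \<bullet> p')
    \<le> F + (norm p)\<^sup>2 / 2 + \<mu> / 2 * \<xi>\<^sup>2 + \<epsilon> * (y \<bullet> p)
      - h * (\<beta> / 4 * (norm p)\<^sup>2 + \<beta> / 2 * (\<mu> * \<xi>\<^sup>2) + \<epsilon> / 2 * F)"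
proof -
  define X Q P G W where defs: "X = (norm p)\<^sup>2" "Q = (norm q)\<^sup>2" "P = (norm p')\<^sup>2"
    "G = (norm g)\<^sup>2" "W = (norm y)\<^sup>2"
  have nonneg: "0 \<le> X" "0 \<le> Q" "0 \<le> P" "0 \<le> G" "0 \<le> W"
    by (simp_all add: defs)
  have QX: "Q \<le> X"
    using qp by (simp add: defs power_mono)
  have a1: "a\<^sup>2 \<le> 1"
    using ab b \<open>0 < h\<close> \<open>0 \<le> \<beta>\<close> by (smt (verit) mult_nonneg_nonneg)
  \<comment> \<open>The term \<open>2 * h * (p' \<bullet> g)\<close> cancels the first order change
    of the potential in \<open>F'\<close>; the term \<open>h\<^sup>2 * G\<close> has a favourable
    sign and is discarded.\<close>
  have aQ: "a\<^sup>2 * Q = P + 2 * h * (p' \<bullet> g) + h\<^sup>2 * G"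
    unfolding defs p' power2_norm_eq_inner
    by (simp add: inner_diff_left inner_diff_right inner_commute algebra_simps power2_eq_square)
  have energy: "F' + P / 2 + \<mu> / 2 * \<xi>'\<^sup>2
      \<le> F + (1 - \<beta> * h) / 2 * (X + \<mu> * \<xi>\<^sup>2) + M / 2 * (h\<^sup>2 * P)"
  proof -
    have "\<mu> * \<xi>'\<^sup>2 = c * (\<mu> * \<xi>\<^sup>2 + (X - Q))"
      using \<open>0 < \<mu>\<close> unfolding \<xi>' by (simp add: defs field_simps)
    also have "\<dots> \<le> b * (\<mu> * \<xi>\<^sup>2 + (X - Q))"
      using cb QX \<open>0 < \<mu>\<close> by (intro mult_right_mono) auto
    \<comment> \<open>With \<open>b\<close> in place of both damping factors, \<open>Q\<close>
      cancels: what friction removes from \<open>p\<close> is exactly what \<open>\<xi>\<close>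
      receives.\<close>
    finally have "a\<^sup>2 * Q + \<mu> * \<xi>'\<^sup>2 \<le> b * (X + \<mu> * \<xi>\<^sup>2)"
      using mult_right_mono[OF ab nonneg(2)] by (simp add: algebra_simps)
    also have "\<dots> \<le> (1 - \<beta> * h) * (X + \<mu> * \<xi>\<^sup>2)"
      using b nonneg \<open>0 < \<mu>\<close> by (intro mult_right_mono) auto
    finally show ?thesis
      using F'[folded defs] aQ mult_nonneg_nonneg[OF zero_le_power2[of h] nonneg(4)]
      unfolding times_divide_eq_left by linarith
  qed
  have cross: "(y + h *\<^sub>R p') \<bullet> p' - y \<bullet> p \<le> h * (P + R\<^sup>2 / (2 * m) * X - F)"
  proof -
    have "(y + h *\<^sub>R p') \<bullet> p' - y \<bullet> p = h * P + y \<bullet> (a *\<^sub>R q - p) - h * (y \<bullet> g)"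
    proof -
      have "(y + h *\<^sub>R p') \<bullet> p' = y \<bullet> (a *\<^sub>R q) - h * (y \<bullet> g) + h * P"
        unfolding inner_add_left defs power2_norm_eq_inner inner_scaleR_left
        by (simp add: p' inner_diff_right)
      then show ?thesis by (simp add: inner_diff_right)
    qed
    moreover have "y \<bullet> (a *\<^sub>R q - p) \<le> h * (m / 2 * W + R\<^sup>2 / (2 * m) * X)"
    proof -
      have "y \<bullet> (a *\<^sub>R q - p) \<le> norm y * (h * (R * norm p))"
        by (rule order_trans[OF norm_cauchy_schwarz mult_left_mono[OF kick]]) simp
      also have "\<dots> = h * (norm y * (R * norm p))"
        by simp
      \<comment> \<open>Young's inequality, weighted so that \<open>m / 2 * W\<close> is exactly
        what strong convexity supplies in \<open>gap\<close>.\<close>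
      also have "norm y * (R * norm p) \<le> m / 2 * W + R\<^sup>2 / (2 * m) * X"
      proof -
        have "0 \<le> (m * norm y - R * norm p)\<^sup>2 / (2 * m)"
          using \<open>0 < m\<close> by simp
        also have "\<dots> = m / 2 * W + R\<^sup>2 / (2 * m) * X - norm y * (R * norm p)"
          using \<open>0 < m\<close> by (simp add: defs field_simps power2_eq_square)
        finally show ?thesis by simp
      qed
      finally show ?thesis using \<open>0 < h\<close> by simp
    qed
    moreover have "h * (F + m / 2 * W) \<le> h * (y \<bullet> g)"
      using gap \<open>0 < h\<close> by (simp add: defs)
    ultimately show ?thesis by (simp add: algebra_simps)
  qed
  have P_le: "P \<le> 2 * X + 4 * M * h\<^sup>2 * F"
  proof -
    \<comment> \<open>Parallelogram identity for \<open>a *\<^sub>R q\<close> and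
      \<open>h *\<^sub>R g\<close>.\<close>
    have "P \<le> 2 * (a\<^sup>2 * Q) + 2 * (h\<^sup>2 * G)"
    proof -
      have "0 \<le> (norm (a *\<^sub>R q + h *\<^sub>R g))\<^sup>2"
        by simp
      also have "\<dots> = 2 * (a\<^sup>2 * Q) + 2 * (h\<^sup>2 * G) - P"
        unfolding defs p' power2_norm_eq_inner
        by (simp add: inner_diff_left inner_diff_right inner_add_left inner_add_right inner_commute
            algebra_simps power2_eq_square)
      finally show ?thesis by simp
    qed
    moreover have "a\<^sup>2 * Q \<le> X"
      using mult_right_mono[OF a1 nonneg(2)] QX by simp
    moreover have "h\<^sup>2 * G \<le> h\<^sup>2 * (2 * M * F)"
      using gap by (intro mult_left_mono) (auto simp: defs)
    ultimately show ?thesis by (simp add: algebra_simps)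
  qed
  \<comment> \<open>By \<open>h \<le> \<epsilon>\<close> the second order error joins the cross term
    error, of order \<open>\<epsilon> * h\<close>. The other bound on \<open>h\<close> keeps the
    resulting share of \<open>F\<close> at one half.\<close>
  have "M / 2 * (h\<^sup>2 * P) + \<epsilon> * (h * P) \<le> h * (\<epsilon> * ((M + 2) * X + F / 2))"
  proof -
    have "M / 2 * (h\<^sup>2 * P) \<le> M / 2 * (h * \<epsilon> * P)"
      using h \<open>0 < h\<close> \<open>0 < M\<close> nonneg
      by (intro mult_left_mono mult_right_mono) (auto simp: power2_eq_square)
    then have "M / 2 * (h\<^sup>2 * P) + \<epsilon> * (h * P) \<le> h * (\<epsilon> * ((M / 2 + 1) * P))"
      by (simp add: algebra_simps)
    also have "(M / 2 + 1) * P \<le> (M / 2 + 1) * (2 * X + 4 * M * h\<^sup>2 * F)"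
      using P_le \<open>0 < M\<close> by (intro mult_left_mono) auto
    also have "\<dots> = (M + 2) * X + (4 * M * (M + 2) * h\<^sup>2) * F / 2"
      by (simp add: algebra_simps)
    also have "\<dots> \<le> (M + 2) * X + F / 2"
      using mult_right_mono[OF h(2) gap(1)] by linarith
    finally show ?thesis
      using \<open>0 < h\<close> \<open>0 \<le> \<epsilon>\<close> by (simp add: mult_left_mono)
  qed
  moreover have "\<epsilon> * ((y + h *\<^sub>R p') \<bullet> p') - \<epsilon> * (y \<bullet> p)
      \<le> \<epsilon> * (h * P) + h * (\<epsilon> * (R\<^sup>2 / (2 * m) * X)) - h * (\<epsilon> * F)"
    using mult_left_mono[OF cross \<open>0 \<le> \<epsilon>\<close>] by (simp add: algebra_simps)
  \<comment> \<open>The errors consume half of the dissipation \<open>\<beta> / 2 * X\<close> and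
    half of \<open>\<epsilon> * F\<close>; the other halves remain in the conclusion.\<close>
  moreover have "h * (\<epsilon> * ((M + 2) * X + F / 2)) + h * (\<epsilon> * (R\<^sup>2 / (2 * m) * X))
      \<le> h * (\<beta> / 4 * X + \<epsilon> / 2 * F)"
  proof -
    have "\<epsilon> * ((M + 2) * X + F / 2) + \<epsilon> * (R\<^sup>2 / (2 * m) * X)
        = \<epsilon> * (M + 2 + R\<^sup>2 / (2 * m)) * X + \<epsilon> / 2 * F"
      by (simp add: algebra_simps add_divide_distrib)
    also have "\<dots> \<le> \<beta> / 4 * X + \<epsilon> / 2 * F"
      using mult_right_mono[OF \<epsilon> nonneg(1)] by simp
    finally show ?thesis
      unfolding distrib_left[of h, symmetric] using \<open>0 < h\<close> by (intro mult_left_mono) auto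
  qed
  moreover have "(1 - \<beta> * h) / 2 * (X + \<mu> * \<xi>\<^sup>2) + h * (\<beta> / 4 * X + \<epsilon> / 2 * F) - h * (\<epsilon> * F)
      = X / 2 + \<mu> / 2 * \<xi>\<^sup>2 - h * (\<beta> / 4 * X + \<beta> / 2 * (\<mu> * \<xi>\<^sup>2) + \<epsilon> / 2 * F)"
    by (simp add: field_simps)
  ultimately show ?thesis
    using energy unfolding defs(1,3)[symmetric] by linarith
qed

section \<open>One-step contraction for the scheme\<close>

context strongly_convex_smooth
begin

definition gap :: "real ^ 'd \<Rightarrow> real" where
  "gap x = f x - f (the_minimizer f)"

definition energy :: "real \<Rightarrow> (real ^ 'd) \<times> (real ^ 'd) \<times> real \<Rightarrow> real" where
  "energy \<mu> = (\<lambda>(x, p, \<xi>). gap x + (norm p)\<^sup>2 / 2 + \<mu> / 2 * \<xi>\<^sup>2)"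

definition lyapunov :: "real \<Rightarrow> real \<Rightarrow> (real ^ 'd) \<times> (real ^ 'd) \<times> real \<Rightarrow> real" where
  "lyapunov \<mu> \<epsilon> = (\<lambda>(x, p, \<xi>). energy \<mu> (x, p, \<xi>) + \<epsilon> * ((x - the_minimizer f) \<bullet> p))"

text \<open>The cross term is at most half the energy: after Young's inequality,
  \<open>\<epsilon> \<le> m / 2\<close> lets the gap absorb the position part and
  \<open>\<epsilon> \<le> 1 / 2\<close> lets the kinetic energy absorb the momentum part.\<close>

lemma lyapunov_energy:
  assumes "0 < \<mu>" and "0 \<le> \<epsilon>" and "\<epsilon> \<le> 1 / 2" and "\<epsilon> \<le> m / 2"
  shows "energy \<mu> s \<le> 2 * lyapunov \<mu> \<epsilon> s" and "lyapunov \<mu> \<epsilon> s \<le> 2 * energy \<mu> s"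
proof -
  obtain x p \<xi> where s: "s = (x, p, \<xi>)"
    by (cases s)
  let ?y = "x - the_minimizer f"
  have "\<bar>\<epsilon> * (?y \<bullet> p)\<bar> \<le> \<epsilon> * (norm ?y * norm p)"
    using \<open>0 \<le> \<epsilon>\<close> by (simp add: abs_mult mult_left_mono Cauchy_Schwarz_ineq2)
  also have "\<dots> \<le> \<epsilon> * (((norm ?y)\<^sup>2 + (norm p)\<^sup>2) / 2)"
    using \<open>0 \<le> \<epsilon>\<close> sum_squares_bound[of "norm ?y" "norm p"] by (intro mult_left_mono) auto
  also have "\<dots> = \<epsilon> * (norm ?y)\<^sup>2 / 2 + \<epsilon> * (norm p)\<^sup>2 / 2"
    by (simp add: algebra_simps add_divide_distrib)
  also have "\<dots> \<le> (m / 2 * (norm ?y)\<^sup>2) / 2 + 1 / 2 * (norm p)\<^sup>2 / 2"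
    using assms by (intro add_mono divide_right_mono mult_right_mono) auto
  also have "\<dots> \<le> (gap x + (norm p)\<^sup>2 / 2) / 2"
    using gap_lower[of x] by (simp add: gap_def add_divide_distrib)
  also have "\<dots> \<le> energy \<mu> s / 2"
    using \<open>0 < \<mu>\<close> by (simp add: energy_def s)
  finally show "energy \<mu> s \<le> 2 * lyapunov \<mu> \<epsilon> s" and "lyapunov \<mu> \<epsilon> s \<le> 2 * energy \<mu> s"
    by (auto simp: lyapunov_def s abs_le_iff)
qed

text \<open>The operator bound \<open>K\<close> concerns \<open>A\<close> at the current point only;
  keeping the trajectory where one \<open>K\<close> works is left to the induction over the
  steps.\<close>

lemma cddba_step_lyapunov:
  assumes pos: "0 < \<mu>" "0 < \<beta>" "\<beta> \<le> \<alpha>" "\<beta> \<le> \<gamma>" "0 < \<epsilon>" "0 < h" "0 \<le> \<xi>"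
    and "psd (A x)" and K: "\<And>v. norm (A x *v v) \<le> K * norm v" and "0 \<le> K"
    and R: "\<gamma> + \<xi> * K \<le> R"
    and small: "\<epsilon> \<le> 1 / 2" "\<epsilon> \<le> m / 2" "\<epsilon> * (M + 2 + R\<^sup>2 / (2 * m)) \<le> \<beta> / 4"
      "h \<le> \<epsilon>" "4 * M * (M + 2) * h\<^sup>2 \<le> 1" "2 * \<beta> * h \<le> 1"
    and \<kappa>: "\<kappa> \<le> \<beta> / 4" "\<kappa> \<le> \<epsilon> / 4" "0 \<le> \<kappa>"
    and step: "cddba_step f A \<mu> \<alpha> \<gamma> h (x, p, \<xi>) = (x', p', \<xi>')"
  shows "0 \<le> \<xi>'"
    and "lyapunov \<mu> \<epsilon> (x', p', \<xi>') \<le> exp (- \<kappa> * h) * lyapunov \<mu> \<epsilon> (x, p, \<xi>)"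
proof -
  define B where "B = (h * \<xi>) *\<^sub>R A x"
  define q where "q = mexp (- B) *v p"
  define a c where "a = exp (- (\<gamma> * h))" and "c = (exp (- \<alpha> * h))\<^sup>2"
  have "psd B"
    using \<open>psd (A x)\<close> pos by (simp add: B_def psd_scaleR)
  have drift: "h *\<^sub>R (\<gamma> *\<^sub>R mat 1 + \<xi> *\<^sub>R A x) = (\<gamma> * h) *\<^sub>R mat 1 + B"
    by (simp add: B_def scaleR_add_right mult.commute)
  have aq: "mexp (- (h *\<^sub>R (\<gamma> *\<^sub>R mat 1 + \<xi> *\<^sub>R A x))) *v p = a *\<^sub>R q"
    unfolding drift a_def q_def
    using \<open>psd B\<close> pos by (intro mexp_uminus_add_mat) auto
  have p': "p' = a *\<^sub>R q - h *\<^sub>R gradient f x" and x': "x' = x + h *\<^sub>R p'"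
    using step by (auto simp: cddba_step_def Let_def aq)
  have qp: "norm q \<le> norm p"
    unfolding q_def by (rule norm_mexp_uminus_le[OF \<open>psd B\<close>])
  have "\<xi>' = exp (- \<alpha> * h) * sqrt (\<xi>\<^sup>2 + 1 / \<mu> * (p \<bullet> ((mat 1 - mexp (- (2 *\<^sub>R B))) *v p)))"
    using step by (simp add: cddba_step_def Let_def B_def mult.assoc mult.commute mult.left_commute)
  also have "p \<bullet> ((mat 1 - mexp (- (2 *\<^sub>R B))) *v p) = (norm p)\<^sup>2 - (norm q)\<^sup>2"
    by (simp add: matrix_vector_mult_diff_rdistrib inner_diff_right power2_norm_eq_inner
        mexp_uminus_scaleR_2[OF \<open>psd B\<close>, unfolded power2_norm_eq_inner] q_def)
  finally have \<xi>'_eq: "\<xi>' = exp (- \<alpha> * h) * sqrt (\<xi>\<^sup>2 + ((norm p)\<^sup>2 - (norm q)\<^sup>2) / \<mu>)"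
    by simp
  have nonneg: "0 \<le> \<xi>\<^sup>2 + ((norm p)\<^sup>2 - (norm q)\<^sup>2) / \<mu>"
    using qp pos by (simp add: power_mono)
  show "0 \<le> \<xi>'"
    unfolding \<xi>'_eq using nonneg by simp
  have \<xi>'_sq: "\<xi>'\<^sup>2 = c * (\<xi>\<^sup>2 + ((norm p)\<^sup>2 - (norm q)\<^sup>2) / \<mu>)"
    unfolding \<xi>'_eq c_def power_mult_distrib using nonneg by simp
  have kick: "norm (a *\<^sub>R q - p) \<le> h * (R * norm p)"
  proof -
    have "norm (h *\<^sub>R (\<gamma> *\<^sub>R mat 1 + \<xi> *\<^sub>R A x) *v w) \<le> h * R * norm w" for w
    proof -
      have "norm (h *\<^sub>R (\<gamma> *\<^sub>R mat 1 + \<xi> *\<^sub>R A x) *v w) = h * norm (\<gamma> *\<^sub>R w + \<xi> *\<^sub>R (A x *v w))"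
        using pos by (simp add: matrix_vector_mult_add_rdistrib flip: scaleR_matrix_vector_assoc)
      also have "norm (\<gamma> *\<^sub>R w + \<xi> *\<^sub>R (A x *v w)) \<le> \<gamma> * norm w + \<xi> * (K * norm w)"
        using pos K by (intro norm_triangle_le add_mono) (auto simp: mult_left_mono)
      also have "\<dots> \<le> R * norm w"
        using mult_right_mono[OF R, of "norm w"] by (simp add: algebra_simps)
      finally show ?thesis using pos by simp
    qed
    from norm_mexp_uminus_diff_le[OF _ this, of p] show ?thesis
      unfolding aq using psd_add_mat[OF \<open>psd B\<close>, of "\<gamma> * h"] pos
      by (simp add: drift mult.assoc)
  qed
  have b: "exp (- (2 * \<beta> * h)) \<le> 1 - \<beta> * h"
    using exp_uminus_le[of "2 * \<beta> * h"] pos small by simp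
  have ab: "a\<^sup>2 \<le> exp (- (2 * \<beta> * h))" and cb: "c \<le> exp (- (2 * \<beta> * h))"
    using pos by (simp_all add: a_def c_def flip: exp_double)
  have F': "gap x' \<le> gap x + h * (p' \<bullet> gradient f x) + M / 2 * (h\<^sup>2 * (norm p')\<^sup>2)"
    using quadratic_upper[of x "h *\<^sub>R p'"]
    by (simp add: gap_def x' power_mult_distrib)
  have g0: "0 \<le> gap x"
    using the_minimizer_le by (simp add: gap_def)
  have g2: "(norm (gradient f x))\<^sup>2 \<le> 2 * M * gap x"
    unfolding gap_def by (rule gradient_sq_le[OF the_minimizer_le])
  have "lyapunov \<mu> \<epsilon> (x', p', \<xi>') \<le> lyapunov \<mu> \<epsilon> (x, p, \<xi>)
      - h * (\<beta> / 4 * (norm p)\<^sup>2 + \<beta> / 2 * (\<mu> * \<xi>\<^sup>2) + \<epsilon> / 2 * gap x)"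
    using lyapunov_step[OF _ _ m_pos M_pos _ p' qp kick ab cb b _ \<xi>'_sq F' g0
        gap_le_inner[of x, folded gap_def] g2 small(4,5,3)] pos
    by (simp add: lyapunov_def energy_def x' algebra_simps)
  \<comment> \<open>The Lyapunov function is at most twice the energy, and the two bounds on
    \<open>\<kappa>\<close> put \<open>2 * \<kappa>\<close> times the energy below the dissipation,
    term by term.\<close>
  also have "\<dots> \<le> lyapunov \<mu> \<epsilon> (x, p, \<xi>) - h * (\<kappa> * lyapunov \<mu> \<epsilon> (x, p, \<xi>))"
  proof -
    have "\<kappa> * lyapunov \<mu> \<epsilon> (x, p, \<xi>) \<le> \<kappa> * (2 * energy \<mu> (x, p, \<xi>))"
      using lyapunov_energy pos small \<kappa> by (intro mult_left_mono) auto
    also have "\<dots> = \<kappa> * (norm p)\<^sup>2 + \<kappa> * (\<mu> * \<xi>\<^sup>2) + 2 * \<kappa> * gap x"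
      by (simp add: energy_def algebra_simps)
    also have "\<dots> \<le> \<beta> / 4 * (norm p)\<^sup>2 + \<beta> / 2 * (\<mu> * \<xi>\<^sup>2) + \<epsilon> / 2 * gap x"
      using pos \<kappa> g0 by (intro add_mono mult_right_mono) auto
    finally show ?thesis using pos by simp
  qed
  also have "\<dots> = (1 + - \<kappa> * h) * lyapunov \<mu> \<epsilon> (x, p, \<xi>)"
    by (simp add: algebra_simps)
  also have "\<dots> \<le> exp (- \<kappa> * h) * lyapunov \<mu> \<epsilon> (x, p, \<xi>)"
  proof (intro mult_right_mono exp_ge_add_one_self)
    have "0 \<le> energy \<mu> (x, p, \<xi>)"
      using pos g0 by (simp add: energy_def)
    then show "0 \<le> lyapunov \<mu> \<epsilon> (x, p, \<xi>)"
      using lyapunov_energy(1)[of \<mu> \<epsilon> "(x, p, \<xi>)"] pos small by simp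
  qed
  finally show "lyapunov \<mu> \<epsilon> (x', p', \<xi>') \<le> exp (- \<kappa> * h) * lyapunov \<mu> \<epsilon> (x, p, \<xi>)" .
qed

section \<open>From one step to uniform decay along trajectories\<close>

lemma gap_nonneg: "0 \<le> gap x"
  using the_minimizer_le by (simp add: gap_def)

text \<open>Confines \<open>x\<close> to a ball and \<open>\<xi>\<close> to an interval, which is
  what the uniform choice of \<open>K\<close> and \<open>R\<close> requires.\<close>

lemma energy_bounds:
  assumes "0 < \<mu>" and "energy \<mu> (x, p, \<xi>) \<le> E"
  shows "norm (x - the_minimizer f) \<le> sqrt (2 * E / m)" and "\<xi> \<le> sqrt (2 * E / \<mu>)"
proof -
  have sum_le: "gap x + (norm p)\<^sup>2 / 2 + \<mu> / 2 * \<xi>\<^sup>2 \<le> E"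
    using assms(2) by (simp add: energy_def)
  have "0 \<le> \<mu> / 2 * \<xi>\<^sup>2"
    using \<open>0 < \<mu>\<close> by simp
  with sum_le have "gap x \<le> E"
    using zero_le_power2[of "norm p"] by linarith
  moreover have "\<mu> / 2 * \<xi>\<^sup>2 \<le> E"
    using sum_le gap_nonneg[of x] zero_le_power2[of "norm p"] by linarith
  moreover have "m / 2 * (norm (x - the_minimizer f))\<^sup>2 \<le> gap x"
    using gap_lower by (simp add: gap_def)
  ultimately show "norm (x - the_minimizer f) \<le> sqrt (2 * E / m)" and "\<xi> \<le> sqrt (2 * E / \<mu>)"
    using m_pos \<open>0 < \<mu>\<close> by (intro real_le_rsqrt; simp add: field_simps)+
qed

lemma energy_initial_le:
  assumes "0 < \<mu>" and "0 \<le> \<xi>" and "norm x + norm p + \<xi> \<le> L"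
  shows "energy \<mu> (x, p, \<xi>) \<le> M / 2 * (L + norm (the_minimizer f))\<^sup>2 + L\<^sup>2 / 2 + \<mu> / 2 * L\<^sup>2"
proof -
  have "gap x \<le> M / 2 * (norm (x - the_minimizer f))\<^sup>2"
    using gap_upper by (simp add: gap_def)
  also have "\<dots> \<le> M / 2 * (L + norm (the_minimizer f))\<^sup>2"
    using M_pos norm_triangle_ineq4[of x "the_minimizer f"] assms norm_ge_zero[of p]
    by (intro mult_left_mono power_mono) (linarith | simp)+
  finally have "gap x \<le> M / 2 * (L + norm (the_minimizer f))\<^sup>2" .
  moreover have "(norm p)\<^sup>2 / 2 \<le> L\<^sup>2 / 2"
    using assms norm_ge_zero[of x] by (intro divide_right_mono power_mono) (linarith | simp)+
  moreover have "\<mu> / 2 * \<xi>\<^sup>2 \<le> \<mu> / 2 * L\<^sup>2"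
    using assms norm_ge_zero[of x] norm_ge_zero[of p] by (intro mult_left_mono power_mono) (linarith | simp)+
  ultimately show ?thesis
    by (simp add: energy_def)
qed

lemma gap_le_energy:
  assumes "0 < \<mu>"
  shows "gap x + (norm p)\<^sup>2 + \<xi>\<^sup>2 \<le> (2 + 2 / \<mu>) * energy \<mu> (x, p, \<xi>)"
proof -
  have "(2 + 2 / \<mu>) * energy \<mu> (x, p, \<xi>) = gap x + (norm p)\<^sup>2 + \<xi>\<^sup>2
      + ((1 + 2 / \<mu>) * gap x + (norm p)\<^sup>2 / \<mu> + \<mu> * \<xi>\<^sup>2)"
    using assms by (simp add: energy_def field_simps)
  moreover have "0 \<le> (1 + 2 / \<mu>) * gap x + (norm p)\<^sup>2 / \<mu> + \<mu> * \<xi>\<^sup>2"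
    using assms gap_nonneg by simp
  ultimately show ?thesis by linarith
qed

theorem cddba_exponential_decay:
  fixes A :: "real ^ 'd \<Rightarrow> real ^ 'd ^ 'd"
  assumes pos: "0 < \<mu>" "0 < \<alpha>" "0 < \<gamma>" and psd: "\<And>x. psd (A x)"
    and bdd: "\<And>K. compact K \<Longrightarrow> bounded (A ` K)"
  shows "\<exists>h\<^sub>0 > 0. \<exists>\<kappa> > 0. \<exists>C \<ge> 0. \<forall>x\<^sub>0 p\<^sub>0 \<xi>\<^sub>0. 0 \<le> \<xi>\<^sub>0 \<longrightarrow> norm x\<^sub>0 + norm p\<^sub>0 + \<xi>\<^sub>0 \<le> L \<longrightarrow>
    (\<forall>h. 0 < h \<longrightarrow> h < h\<^sub>0 \<longrightarrow> (\<forall>n x p \<xi>. cddba f A \<mu> \<alpha> \<gamma> h (x\<^sub>0, p\<^sub>0, \<xi>\<^sub>0) n = (x, p, \<xi>) \<longrightarrow>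
      gap x + (norm p)\<^sup>2 + \<xi>\<^sup>2 \<le> C * exp (- \<kappa> * real n * h)))"
proof -
  define E where "E = M / 2 * (L + norm (the_minimizer f))\<^sup>2 + L\<^sup>2 / 2 + \<mu> / 2 * L\<^sup>2"
  have E0: "0 \<le> E"
    unfolding E_def using M_pos pos by (intro add_nonneg_nonneg mult_nonneg_nonneg) auto
  \<comment> \<open>The level \<open>4 * E\<close>: initial energy at most \<open>E\<close> gives a
    Lyapunov value at most \<open>2 * E\<close>; while the latter persists, the energy is at most
    \<open>4 * E\<close>.\<close>
  obtain K where K0: "0 \<le> K"
    and K: "\<And>X v. X \<in> A ` cball (the_minimizer f) (sqrt (2 * (4 * E) / m)) \<Longrightarrow>
      norm (X *v v) \<le> K * norm v"
    using bounded_matrices_imp_uniform_bound[OF bdd[OF compact_cball]] by blast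
  define R where "R = \<gamma> + sqrt (2 * (4 * E) / \<mu>) * K"
  define \<beta> where "\<beta> = min \<alpha> \<gamma>"
  define D where "D = M + 2 + R\<^sup>2 / (2 * m)"
  define \<epsilon> where "\<epsilon> = Min {1 / 2, m / 2, \<beta> / 4 / D}"
  define N where "N = 4 * M * (M + 2)"
  \<comment> \<open>The entry 1 gives \<open>h\<^sup>2 \<le> h\<close>, so the entry
    \<open>1 / N\<close> suffices for the quadratic condition on \<open>h\<close>. The entry
    \<open>1 / (2 * \<beta>)\<close> keeps the argument of \<open>exp_uminus_le\<close> at most
    1.\<close>
  define h\<^sub>0 where "h\<^sub>0 = Min {1, \<epsilon>, 1 / (2 * \<beta>), 1 / N}"
  define \<kappa> where "\<kappa> = min (\<beta> / 4) (\<epsilon> / 4)"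
  have \<beta>: "0 < \<beta>" "\<beta> \<le> \<alpha>" "\<beta> \<le> \<gamma>"
    using pos by (auto simp: \<beta>_def)
  have D: "0 < D"
    unfolding D_def using M_pos m_pos by (intro add_pos_nonneg) auto
  have N: "0 < N"
    using M_pos by (simp add: N_def)
  have \<epsilon>: "0 < \<epsilon>" "\<epsilon> \<le> 1 / 2" "\<epsilon> \<le> m / 2" "\<epsilon> * D \<le> \<beta> / 4"
  proof -
    show "0 < \<epsilon>" "\<epsilon> \<le> 1 / 2" "\<epsilon> \<le> m / 2"
      using m_pos \<beta> D by (simp_all add: \<epsilon>_def)
    have "\<epsilon> \<le> \<beta> / 4 / D"
      by (simp add: \<epsilon>_def)
    with D show "\<epsilon> * D \<le> \<beta> / 4"
      by (simp add: pos_le_divide_eq)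
  qed
  have h\<^sub>0: "0 < h\<^sub>0"
    using \<beta> \<epsilon> N by (simp add: h\<^sub>0_def)
  have \<kappa>: "0 < \<kappa>" "\<kappa> \<le> \<beta> / 4" "\<kappa> \<le> \<epsilon> / 4"
    using \<beta> \<epsilon> by (simp_all add: \<kappa>_def)
  have main: "gap x + (norm p)\<^sup>2 + \<xi>\<^sup>2 \<le> (2 + 2 / \<mu>) * (4 * E) * exp (- \<kappa> * real n * h)"
    if init: "0 \<le> \<xi>\<^sub>0" "norm x\<^sub>0 + norm p\<^sub>0 + \<xi>\<^sub>0 \<le> L" and h: "0 < h" "h < h\<^sub>0"
      and run: "cddba f A \<mu> \<alpha> \<gamma> h (x\<^sub>0, p\<^sub>0, \<xi>\<^sub>0) n = (x, p, \<xi>)"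
    for x\<^sub>0 p\<^sub>0 \<xi>\<^sub>0 h n x p \<xi>
  proof -
    have small: "h \<le> \<epsilon>" "4 * M * (M + 2) * h\<^sup>2 \<le> 1" "2 * \<beta> * h \<le> 1"
    proof -
      show "h \<le> \<epsilon>"
        using h by (simp add: h\<^sub>0_def)
      have "h \<le> 1" "h \<le> 1 / N" "h \<le> 1 / (2 * \<beta>)"
        using h by (simp_all add: h\<^sub>0_def)
      then have "N * h \<le> 1" and "2 * \<beta> * h \<le> 1"
        using N \<beta> by (simp_all add: pos_le_divide_eq mult.commute mult.left_commute)
      then show "2 * \<beta> * h \<le> 1" by simp
      have "N * h\<^sup>2 \<le> N * h"
        using N h \<open>h \<le> 1\<close> by (simp add: power2_eq_square mult_left_le)
      with \<open>N * h \<le> 1\<close> show "4 * M * (M + 2) * h\<^sup>2 \<le> 1"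
        by (simp add: N_def)
    qed
    \<comment> \<open>Decay and confinement are proved together: the bound at step \<open>n\<close>
      keeps the iterate where \<open>K\<close> and \<open>R\<close> are valid, which licenses step
      \<open>Suc n\<close>.\<close>
    have decay: "0 \<le> \<xi> \<and> lyapunov \<mu> \<epsilon> (x, p, \<xi>) \<le> 2 * E * exp (- \<kappa> * real n * h)"
      using run
    proof (induction n arbitrary: x p \<xi>)
      case 0
      then show ?case
        using energy_initial_le[OF pos(1) init] lyapunov_energy(2)[OF pos(1) _ \<epsilon>(2,3), of "(x, p, \<xi>)"] init \<epsilon>(1)
        by (auto simp: cddba_def E_def)
    next
      case (Suc n)
      obtain x1 p1 \<xi>1 where s: "cddba f A \<mu> \<alpha> \<gamma> h (x\<^sub>0, p\<^sub>0, \<xi>\<^sub>0) n = (x1, p1, \<xi>1)"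
        by (metis prod_cases3)
      from Suc.IH[OF s] have IH: "0 \<le> \<xi>1"
        "lyapunov \<mu> \<epsilon> (x1, p1, \<xi>1) \<le> 2 * E * exp (- \<kappa> * real n * h)"
        by auto
      have step: "cddba_step f A \<mu> \<alpha> \<gamma> h (x1, p1, \<xi>1) = (x, p, \<xi>)"
        using Suc.prems s by (simp add: cddba_def)
      have "2 * E * exp (- \<kappa> * real n * h) \<le> 2 * E"
        using E0 \<kappa> h by (simp add: mult_left_le)
      then have "energy \<mu> (x1, p1, \<xi>1) \<le> 4 * E"
        using lyapunov_energy(1)[OF pos(1) _ \<epsilon>(2,3), of "(x1, p1, \<xi>1)"] IH \<epsilon>(1) by simp
      from energy_bounds[OF pos(1) this]
      have x1: "x1 \<in> cball (the_minimizer f) (sqrt (2 * (4 * E) / m))"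
        and \<xi>1: "\<xi>1 \<le> sqrt (2 * (4 * E) / \<mu>)"
        by (simp_all add: dist_norm norm_minus_commute)
      have R: "\<gamma> + \<xi>1 * K \<le> R"
        unfolding R_def using \<xi>1 K0 by (simp add: mult_right_mono)
      note next_step = cddba_step_lyapunov[where \<mu> = \<mu> and \<beta> = \<beta> and \<epsilon> = \<epsilon> and \<kappa> = \<kappa> and A = A,
          OF pos(1) \<beta> \<epsilon>(1) h(1) IH(1) psd K[OF imageI[OF x1]] K0 R \<epsilon>(2,3) \<epsilon>(4)[unfolded D_def]
          small \<kappa>(2,3) less_imp_le[OF \<kappa>(1)] step]
      have "lyapunov \<mu> \<epsilon> (x, p, \<xi>) \<le> exp (- \<kappa> * h) * lyapunov \<mu> \<epsilon> (x1, p1, \<xi>1)"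
        by (rule next_step)
      also have "\<dots> \<le> exp (- \<kappa> * h) * (2 * E * exp (- \<kappa> * real n * h))"
        using IH by simp
      also have "\<dots> = 2 * E * exp (- \<kappa> * real (Suc n) * h)"
        by (simp add: mult_exp_exp algebra_simps)
      finally show ?case
        using next_step(1) by simp
    qed
    have "gap x + (norm p)\<^sup>2 + \<xi>\<^sup>2 \<le> (2 + 2 / \<mu>) * energy \<mu> (x, p, \<xi>)"
      by (rule gap_le_energy[OF pos(1)])
    also have "\<dots> \<le> (2 + 2 / \<mu>) * (2 * (2 * E * exp (- \<kappa> * real n * h)))"
      using lyapunov_energy(1)[OF pos(1) _ \<epsilon>(2,3), of "(x, p, \<xi>)"] decay \<epsilon>(1) pos
      by (intro mult_left_mono) auto
    finally show ?thesis
      by (simp add: mult.assoc)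
  qed
  show ?thesis
  proof (intro exI conjI allI impI)
    show "0 \<le> (2 + 2 / \<mu>) * (4 * E)"
      using pos E0 by simp
  qed (fact h\<^sub>0 \<kappa>(1) main)+
qed

end

theorem proposition5p2:
  fixes f :: "real ^ 'd \<Rightarrow> real"
    and A :: "real ^ 'd \<Rightarrow> real ^ 'd ^ 'd"
    and \<mu> \<alpha> \<gamma> m M L :: real
  assumes "0 < \<mu>" and "0 < \<alpha>" and "0 < \<gamma>"
    and "C2 f"
    and "0 < m" and "m \<le> M"
    and "\<And>x. loewner_le (m *\<^sub>R mat 1) (hessian f x)"
    and "\<And>x. loewner_le (hessian f x) (M *\<^sub>R mat 1)"
    and "\<And>x. psd (A x)"
    and "\<And>K. compact K \<Longrightarrow> bounded (A ` K)"
    and "0 \<le> L"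
  shows "\<exists>\<delta>t_star > 0. \<exists>\<kappa> > 0. \<exists>C \<ge> 0.
    \<forall>x\<^sub>0 p\<^sub>0 \<xi>\<^sub>0. 0 \<le> \<xi>\<^sub>0 \<longrightarrow> norm x\<^sub>0 + norm p\<^sub>0 + \<xi>\<^sub>0 \<le> L \<longrightarrow>
      (\<forall>\<delta>t. 0 < \<delta>t \<longrightarrow> \<delta>t < \<delta>t_star \<longrightarrow>
        (\<forall>n x p \<xi>. cddba f A \<mu> \<alpha> \<gamma> \<delta>t (x\<^sub>0, p\<^sub>0, \<xi>\<^sub>0) n = (x, p, \<xi>) \<longrightarrow>
          f x - f (the_minimizer f) + (norm p)\<^sup>2 + \<xi>\<^sup>2 \<le> C * exp (- \<kappa> * real n * \<delta>t)))"
proof -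
  interpret strongly_convex_smooth f m M
    using assms by unfold_locales
  show ?thesis
    using cddba_exponential_decay[of \<mu> \<alpha> \<gamma> A L] assms by (simp add: gap_def)
qed

end
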